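(* Let $A\in\mathbb{R}^{m\times r}$ with $m\ge r$ have full rank, let $z^\star\in\mathbb{R}^r$ have nonnegative entries, $r^\star=\#\operatorname{supp}(z^\star)$, $b=Az^\star$. Apply the LMM method with $F(x)=x\odot x$ and $h(z)=\frac12\|Az-b\|_2^2$ (i.e. to $\min_{x\in\mathbb{R}^r}\frac12\|A(x\odot x)-b\|_2^2$), initialized at $x_0\in\mathbb{R}^r$ and with the Polyak configuration with parameters $\gamma,C_{\mathtt{lb}},C_{\mathtt{ub}}$ satisfying $$\gamma\le\min\left\{1,\frac{C_{\mathtt{lb}}}{2}\right\},\qquad C_{\mathtt{ub}}\le\left(2^8\max\{\sqrt{r-r^\star},1\}\right)^{-1}\kappa(A)^{-4},$$ and suppose $$\|x_0\odot x_0-z^\star\|_2\le\frac12\min\left\{\min_{\substack{i,j\in[r]\\ z^\star_i\ne z^\star_j}}|z^\star_i-z^\star_j|,\ \min_{\substack{i\in[r]\\ z^\star_i\ne0}}z^\star_i\right\}.$$ Then the iterates satisfy $$\|x_k\odot x_k-z^\star\|_2^2\le\left(1-\frac{\gamma}{32}\kappa(A)^{-2}\right)^k\|x_0\odot x_0-z^\star\|_2^2\quad\text{for all }k\ge0.$$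
   Context: $\odot$ is the componentwise product, $\operatorname{supp}(z)$ the set of indices of nonzero entries, $\#$ cardinality, $[r]=\{1,\dots,r\}$; a minimum over an empty set is $+\infty$. $\kappa(A)=\sigma_{\max}(A)/\sigma_{\min}(A)$ with $\sigma_{\min}(A)$ the smallest nonzero singular value. LMM (Levenberg-Morrison-Marquardt) method for $f=h\circ F$. Given $x_0$, stepsizes $\gamma_k>0$ and damping coefficients $\lambda_k>0$: for $k\ge0$ let $v_k=\nabla h(F(x_k))$ and set $x_{k+1}=x_k-\gamma_k(\nabla F(x_k)^\top\nabla F(x_k)+\lambda_kI)^{-1}\nabla F(x_k)^\top v_k$, where $\nabla F$ is the Jacobian. Write $z_k=F(x_k)$; let $h^\star$, $\mathcal{Z}^\star$ be the minimum value and set of minimizers of $h$ over $\operatorname{Im}F$, and $\Pi^x$ the orthogonal projection onto the range of $\nabla F(x)$. Polyak configuration with parameters $\gamma>0$, $0<C_{\mathtt{lb}}\le C_{\mathtt{ub}}$: $\gamma_k=\gamma\frac{h(z_k)-h^\star}{\|\Pi^{x_k}v_k\|^2}$ and $C_{\mathtt{lb}}\operatorname{dist}(z_k,\mathcal{Z}^\star)\le\lambda_k\le C_{\mathtt{ub}}\operatorname{dist}(z_k,\mathcal{Z}^\star)$ for all $k$. *)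

theory Defs
  imports "HOL-Analysis.Analysis"
begin

definition singular_values :: "real^'n^'m \<Rightarrow> real set" where
  "singular_values A =
     {\<sigma>. 0 \<le> \<sigma> \<and> (\<exists>v. v \<noteq> 0 \<and> (transpose A ** A) *v v = \<sigma>\<^sup>2 *\<^sub>R v)}"

definition sigma_max :: "real^'n^'m \<Rightarrow> real" where
  "sigma_max A = Max (singular_values A)"

definition sigma_min :: "real^'n^'m \<Rightarrow> real" where
  "sigma_min A = Min (singular_values A - {0})"

definition cond_number :: "real^'n^'m \<Rightarrow> real" where
  "cond_number A = sigma_max A / sigma_min A"

definition supp :: "real^'n \<Rightarrow> 'n set" where
  "supp z = {i. z $ i \<noteq> 0}"

definition grad :: "('a::real_inner \<Rightarrow> real) \<Rightarrow> 'a \<Rightarrow> 'a" where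
  "grad f z = (THE g. GDERIV f z :> g)"

definition orth_proj :: "'a::euclidean_space set \<Rightarrow> 'a \<Rightarrow> 'a" where
  "orth_proj S v = (THE p. p \<in> S \<and> (\<forall>s\<in>S. orthogonal (v - p) s))"

text \<open>The minimum value of \<open>h\<close> over the image of \<open>F\<close>, and the set of its minimizers there
  (points of the image of \<open>F\<close>, not of its domain).\<close>

definition min_val :: "('b \<Rightarrow> real) \<Rightarrow> ('a \<Rightarrow> 'b) \<Rightarrow> real" where
  "min_val h F = (INF z\<in>range F. h z)"

definition minimizers :: "('b \<Rightarrow> real) \<Rightarrow> ('a \<Rightarrow> 'b) \<Rightarrow> 'b set" where
  "minimizers h F = {z. is_arg_min h (\<lambda>z. z \<in> range F) z}"

text \<open>Positivity of the parameters is only required as long as \<open>F (x k)\<close> is not yet a minimizer: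
  the Polyak configuration below forces \<open>lam k = 0\<close> once it is one, so unrestricted positivity
  would exclude runs that reach a minimizer after finitely many steps.  At such an iterate the
  gradient of \<open>h \<circ> F\<close>, which is the vector the inverse matrix is applied to, vanishes;
  hence \<open>x (Suc k) = x k\<close> there, whatever the values of \<open>gam k\<close>, \<open>lam k\<close> and of the
  (possibly unspecified) inverse.\<close>

definition lmm_iterates ::
  "(real^'p \<Rightarrow> real) \<Rightarrow> (real^'n \<Rightarrow> real^'p) \<Rightarrow> (nat \<Rightarrow> real) \<Rightarrow> (nat \<Rightarrow> real) \<Rightarrow> (nat \<Rightarrow> real^'n) \<Rightarrow> bool"
where
  "lmm_iterates h F gam lam x \<longleftrightarrow>
     (\<forall>k. (F (x k) \<notin> minimizers h F \<longrightarrow> 0 < gam k \<and> 0 < lam k) \<and>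
          (let J = jacobian F (at (x k)); v = grad h (F (x k))
           in x (Suc k) =
                x k - gam k *\<^sub>R
                  (matrix_inv (transpose J ** J + lam k *\<^sub>R mat 1) *v (transpose J *v v))))"

text \<open>When \<open>F (x k)\<close> is a minimizer, the quotient below has numerator \<open>0\<close> and so equals \<open>0\<close>,
  also if its denominator is \<open>0\<close>.\<close>

definition polyak_config ::
  "(real^'p \<Rightarrow> real) \<Rightarrow> (real^'n \<Rightarrow> real^'p) \<Rightarrow> real \<Rightarrow> real \<Rightarrow> real \<Rightarrow>
   (nat \<Rightarrow> real) \<Rightarrow> (nat \<Rightarrow> real) \<Rightarrow> (nat \<Rightarrow> real^'n) \<Rightarrow> bool"
where
  "polyak_config h F \<gamma> Clb Cub gam lam x \<longleftrightarrow>
     0 < \<gamma> \<and> 0 < Clb \<and> Clb \<le> Cub \<and>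
     (\<forall>k. let z = F (x k); v = grad h z; R = range (\<lambda>u. jacobian F (at (x k)) *v u)
          in gam k = \<gamma> * ((h z - min_val h F) / (norm (orth_proj R v))\<^sup>2) \<and>
             Clb * infdist z (minimizers h F) \<le> lam k \<and>
             lam k \<le> Cub * infdist z (minimizers h F))"

end

theory Submission
  imports Defs
begin

text \<open>
  For \<open>F x = x \<odot> x\<close> the Jacobian is \<open>2 diag x\<close>, so the damped normal equations decouple.
  Write \<open>z = x \<odot> x\<close>, \<open>e = z - z\<^sup>*\<close>, \<open>d = \<parallel>e\<parallel>\<close>, \<open>\<phi> = h z = \<parallel>A e\<parallel>\<^sup>2 / 2\<close> and
  \<open>v = A\<^sup>T A e\<close>, the gradient of \<open>h\<close> at \<open>z\<close>.  One iteration maps each coordinate \<open>z\<^sub>i\<close> to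
  \<open>z\<^sub>i (1 - 2 t\<^sub>i)\<^sup>2\<close> with \<open>t\<^sub>i = g v\<^sub>i / (4 z\<^sub>i + \<lambda>)\<close>, hence
  \<open>e\<^sub>i\<close> to \<open>e\<^sub>i - g a\<^sub>i (1 - t\<^sub>i)\<close> with \<open>a\<^sub>i = (4 z\<^sub>i / (4 z\<^sub>i + \<lambda>)) v\<^sub>i\<close>.  It is a gradient step on \<open>h\<close>
  whose coordinates are shrunk by the damping and perturbed by the second-order term \<open>t\<^sub>i\<close>.

  The damping is harmless (\<open>damping_loss_bound\<close>).  Without it, \<open>e \<bullet> v = 2 \<phi>\<close>.  In a
  coordinate with \<open>z\<^sup>*\<^sub>i = 0\<close> we have \<open>e\<^sub>i = z\<^sub>i\<close>, so the factor \<open>\<lambda> / (4 z\<^sub>i + \<lambda>)\<close> that is lost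
  satisfies \<open>(\<lambda> / (4 z\<^sub>i + \<lambda>)) e\<^sub>i \<le> \<lambda> / 4\<close>, which is of order \<open>d\<close> since \<open>\<lambda>\<close> is.
  In a coordinate of the support the initial closeness gives \<open>z\<^sub>i \<ge> d\<close>, so that the factor itself is of the order of \<open>\<lambda> / d\<close>.
  The upper bound on \<open>\<lambda>\<close> makes the total at most \<open>\<phi> / 256\<close>, so \<open>e \<bullet> a\<close> is almost \<open>2 \<phi>\<close>.

  The second-order term is harmless (\<open>damped_polyak_step_decrease\<close>).  Let \<open>w\<close> be the
  projection of \<open>v\<close> onto the range of the Jacobian.  The Polyak stepsize satisfies
  \<open>g \<parallel>w\<parallel>\<^sup>2 = \<gamma> \<phi>\<close>, and \<open>2 \<phi> \<approx> e \<bullet> a \<le> d \<parallel>w\<parallel>\<close> turns this into \<open>g \<parallel>w\<parallel> \<le> \<gamma> d / 2\<close>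
  up to a factor near \<open>1\<close>.  As \<open>\<lambda>\<close> is at least \<open>c d\<close> and \<open>\<gamma> \<le> c / 2\<close>, the relative
  perturbation \<open>\<bar>t\<^sub>i\<bar>\<close> is at most about \<open>1/4\<close> wherever \<open>z\<^sub>i \<noteq> 0\<close>.
  Summing squares, \<open>\<parallel>e\<parallel>\<^sup>2\<close> decreases by at least \<open>g \<phi>\<close>.

  Finally \<open>g \<phi> \<ge> \<gamma> \<phi>\<^sup>2 / \<parallel>v\<parallel>\<^sup>2\<close>, and since \<open>\<parallel>v\<parallel>\<^sup>2 \<le> 2 \<sigma>\<^sub>m\<^sub>a\<^sub>x\<^sup>2 \<phi>\<close> and
  \<open>2 \<phi> \<ge> \<sigma>\<^sub>m\<^sub>i\<^sub>n\<^sup>2 d\<^sup>2\<close>, the decrease is at least \<open>(\<gamma> / (4 \<kappa>\<^sup>2)) d\<^sup>2\<close>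
  (\<open>least_squares_polyak_step\<close>).  In particular the distance to \<open>z\<^sup>*\<close> never grows, so
  the closeness to \<open>z\<^sup>*\<close> persists and the estimate can be iterated.
\<close>

section \<open>Extreme singular values\<close>

text \<open>As a rewrite rule this would destroy the shape in which the transpose enters the definitions.\<close>

declare transpose_matrix_vector [simp del]

lemma inner_transpose_mult: "(transpose A *v y) \<bullet> x = y \<bullet> (A *v x)" for A :: "real^'n^'m"
  unfolding transpose_matrix_vector by (rule dot_lmul_matrix)

lemma inner_gram: "((transpose A ** A) *v x) \<bullet> y = (A *v x) \<bullet> (A *v y)" for A :: "real^'n^'m"
  by (simp add: inner_transpose_mult matrix_vector_mul_assoc[symmetric])

text \<open>The quadratic form is minimal at \<open>v\<close>, so it cannot decrease along the direction \<open>- g v\<close>;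
  its derivative in that direction is \<open>- 2 \<parallel>g v\<parallel>\<^sup>2\<close>.\<close>

lemma symmetric_psd_null_vector:
  fixes g :: "'a::real_inner \<Rightarrow> 'a"
  assumes lin: "linear g" and sym: "\<And>u w. g u \<bullet> w = u \<bullet> g w"
    and psd: "\<And>u. 0 \<le> g u \<bullet> u" and null: "g v \<bullet> v = 0"
  shows "g v = 0"
proof (rule ccontr)
  assume "g v \<noteq> 0"
  define a c where "a = g v \<bullet> g v" and "c = g (g v) \<bullet> g v"
  \<comment> \<open>Along \<open>v - t g v\<close> the form equals \<open>t (t c - 2 a)\<close>, which is negative for \<open>0 < t\<close> with \<open>t c < 2 a\<close>;
    the summand \<open>1\<close> covers the case \<open>c = 0\<close>.\<close>
  define t where "t = a / (c + 1)"
  have a: "0 < a" and c: "0 \<le> c" using \<open>g v \<noteq> 0\<close> psd by (simp_all add: a_def c_def)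
  then have t: "0 < t" by (simp add: t_def)
  have "g (v - t *\<^sub>R g v) \<bullet> (v - t *\<^sub>R g v) = t * (t * c - 2 * a)"
    using null sym[of v "g v"] sym[of "g v" v]
    by (simp add: linear_diff[OF lin] linear_scale[OF lin] inner_diff_left inner_diff_right a_def c_def
        algebra_simps inner_commute)
  also have "t * c - 2 * a = a * (c / (c + 1) - 2)" by (simp add: t_def field_simps)
  also have "t * \<dots> < 0"
    using a c t by (intro mult_pos_neg) (auto simp: field_simps)
  finally show False using psd[of "v - t *\<^sub>R g v"] by simp
qed

text \<open>A unit vector at which \<open>\<parallel>A v\<parallel>\<close> is extremal is a null vector of a semidefinite shift of the Gram
  matrix.  The sign \<open>c\<close> treats maximisers and minimisers at once.\<close>

lemma gram_eigenvector_if_extremal: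
  fixes A :: "real^'n^'m"
  assumes v: "norm v = 1" and c: "c = 1 \<or> c = -1"
    and ext: "\<And>u. c * (norm (A *v u))\<^sup>2 \<le> c * ((norm (A *v v))\<^sup>2 * (norm u)\<^sup>2)"
  shows "(transpose A ** A) *v v = (norm (A *v v))\<^sup>2 *\<^sub>R v"
proof -
  define g where "g u = c *\<^sub>R ((norm (A *v v))\<^sup>2 *\<^sub>R u - (transpose A ** A) *v u)" for u
  have g_inner: "g u \<bullet> w = c * ((norm (A *v v))\<^sup>2 * (u \<bullet> w) - (A *v u) \<bullet> (A *v w))" for u w
    by (simp add: g_def inner_diff_left inner_gram)
  have "g v = 0"
  proof (rule symmetric_psd_null_vector[where g = g])
    show "linear g"
      by (rule linearI) (simp_all add: g_def algebra_simps matrix_vector_mult_scaleR matrix_vector_right_distrib)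
    show "g u \<bullet> w = u \<bullet> g w" for u w
      using g_inner[of u w] g_inner[of w u] by (simp add: inner_commute)
    show "0 \<le> g u \<bullet> u" for u
      using ext[of u] by (simp add: g_inner power2_norm_eq_inner algebra_simps)
    show "g v \<bullet> v = 0"
      using v by (simp add: g_inner flip: power2_norm_eq_inner)
  qed
  then show ?thesis using c by (auto simp: g_def)
qed

text \<open>Eigenvectors of the Gram matrix for different singular values are orthogonal, and a finite-dimensional
  space has no infinite set of pairwise orthogonal nonzero vectors.\<close>

lemma finite_singular_values: "finite (singular_values A)" for A :: "real^'n^'m"
proof -
  let ?S = "singular_values A"
  have "\<forall>s\<in>?S. \<exists>v. v \<noteq> 0 \<and> (transpose A ** A) *v v = s\<^sup>2 *\<^sub>R v"
    by (auto simp: singular_values_def)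
  then obtain e where e: "\<And>s. s \<in> ?S \<Longrightarrow> e s \<noteq> 0 \<and> (transpose A ** A) *v e s = s\<^sup>2 *\<^sub>R e s"
    by metis
  have orth: "e s \<bullet> e t = 0" if "s \<in> ?S" "t \<in> ?S" "s \<noteq> t" for s t
  proof -
    have "s\<^sup>2 * (e s \<bullet> e t) = t\<^sup>2 * (e s \<bullet> e t)"
      using inner_gram[of A "e s" "e t"] inner_gram[of A "e t" "e s"] e[OF that(1)] e[OF that(2)]
      by (simp add: inner_commute)
    moreover have "s\<^sup>2 \<noteq> t\<^sup>2" using that by (auto simp: singular_values_def power2_eq_iff)
    ultimately show ?thesis by simp
  qed
  have "inj_on e ?S"
    using orth e by (metis inj_onI inner_eq_zero_iff)
  moreover have "finite (e ` ?S)"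
    by (rule pairwise_orthogonal_imp_finite) (auto simp: pairwise_def orthogonal_def intro: orth)
  ultimately show ?thesis by (rule finite_imageD[rotated])
qed

lemma ex_norm_eq_1: "\<exists>v::real^'n. norm v = 1"
  by (intro exI[of _ "axis undefined 1"]) simp

text \<open>The maximum of \<open>\<parallel>A v\<parallel>\<close> over the unit sphere is attained and is itself a singular value,
  hence at most the largest one.\<close>

lemma
  fixes A :: "real^'n^'m"
  shows sigma_max_mem: "sigma_max A \<in> singular_values A"
    and norm_mult_le_sigma_max: "norm (A *v u) \<le> sigma_max A * norm u"
proof -
  have "sphere 0 1 \<noteq> ({} :: (real^'n) set)" using ex_norm_eq_1 by auto
  then obtain v where v: "norm v = 1" and max: "\<And>w. norm w = 1 \<Longrightarrow> norm (A *v w) \<le> norm (A *v v)"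
    using continuous_attains_sup[of "sphere 0 1" "\<lambda>w. norm (A *v w)"]
    by (auto simp: continuous_intros matrix_vector_mult_linear_continuous_on)
  have bound: "norm (A *v u) \<le> norm (A *v v) * norm u" for u
  proof (cases "u = 0")
    case False
    then show ?thesis using max[of "u /\<^sub>R norm u"]
      by (simp add: matrix_vector_mult_scaleR field_simps)
  qed simp
  have "(transpose A ** A) *v v = (norm (A *v v))\<^sup>2 *\<^sub>R v"
    using v bound by (intro gram_eigenvector_if_extremal[of v 1]) (auto simp flip: power_mult_distrib)
  then have mem: "norm (A *v v) \<in> singular_values A"
    using v by (auto simp: singular_values_def intro!: exI[of _ v])
  show "sigma_max A \<in> singular_values A"
    unfolding sigma_max_def using finite_singular_values mem by (intro Max_in) auto
  have "norm (A *v v) \<le> sigma_max A"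
    unfolding sigma_max_def using mem finite_singular_values by (intro Max_ge) auto
  with bound[of u] show "norm (A *v u) \<le> sigma_max A * norm u"
    by (meson mult_right_mono norm_ge_zero order_trans)
qed

lemma
  fixes A :: "real^'n^'m"
  assumes inj: "inj ((*v) A)"
  shows sigma_min_pos: "0 < sigma_min A"
    and sigma_min_le_norm_mult: "sigma_min A * norm u \<le> norm (A *v u)"
proof -
  have nz: "A *v w \<noteq> 0" if "w \<noteq> 0" for w
    using injD[OF inj, of w 0] that by auto
  have "sphere 0 1 \<noteq> ({} :: (real^'n) set)" using ex_norm_eq_1 by auto
  then obtain v where v: "norm v = 1" and min: "\<And>w. norm w = 1 \<Longrightarrow> norm (A *v v) \<le> norm (A *v w)"
    using continuous_attains_inf[of "sphere 0 1" "\<lambda>w. norm (A *v w)"]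
    by (auto simp: continuous_intros matrix_vector_mult_linear_continuous_on)
  have bound: "norm (A *v v) * norm u \<le> norm (A *v u)" for u
  proof (cases "u = 0")
    case False
    then show ?thesis using min[of "u /\<^sub>R norm u"]
      by (simp add: matrix_vector_mult_scaleR field_simps)
  qed simp
  have "(transpose A ** A) *v v = (norm (A *v v))\<^sup>2 *\<^sub>R v"
    using v bound by (intro gram_eigenvector_if_extremal[of v "-1"]) (auto simp flip: power_mult_distrib)
  moreover have "v \<noteq> 0" using v by auto
  ultimately have mem: "norm (A *v v) \<in> singular_values A - {0}"
    using nz[of v] by (auto simp: singular_values_def)
  have "sigma_min A \<in> singular_values A - {0}"
    unfolding sigma_min_def using finite_singular_values mem by (intro Min_in) auto
  then show "0 < sigma_min A" by (auto simp: singular_values_def)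
  have "sigma_min A \<le> norm (A *v v)"
    unfolding sigma_min_def using mem finite_singular_values by (intro Min_le) auto
  with bound[of u] show "sigma_min A * norm u \<le> norm (A *v u)"
    by (meson mult_right_mono norm_ge_zero order_trans)
qed

text \<open>The identity \<open>\<parallel>A\<^sup>T y\<parallel>\<^sup>2 = y \<bullet> A (A\<^sup>T y)\<close> reduces the claim to the bound
  for \<open>A\<close>.\<close>

lemma norm_transpose_mult_le_sigma_max:
  "norm (transpose A *v y) \<le> sigma_max A * norm y" for A :: "real^'n^'m"
proof (cases "transpose A *v y = 0")
  case True
  then show ?thesis using sigma_max_mem[of A] by (simp add: singular_values_def)
next
  case False
  let ?w = "transpose A *v y"
  have "(norm ?w)\<^sup>2 = y \<bullet> (A *v ?w)"
    by (simp add: power2_norm_eq_inner inner_transpose_mult)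
  also have "\<dots> \<le> norm y * (sigma_max A * norm ?w)"
    by (meson norm_cauchy_schwarz norm_mult_le_sigma_max mult_left_mono norm_ge_zero order_trans)
  finally show ?thesis using False by (simp add: power2_eq_square mult.commute mult.left_commute)
qed

lemma sigma_min_le_sigma_max:
  fixes A :: "real^'n^'m"
  assumes "inj ((*v) A)" shows "sigma_min A \<le> sigma_max A"
proof -
  obtain v :: "real^'n" where "norm v = 1" using ex_norm_eq_1 by blast
  then show ?thesis
    using sigma_min_le_norm_mult[OF assms, of v] norm_mult_le_sigma_max[of A v] by simp
qed

section \<open>The ingredients of the method for the Hadamard square\<close>

lemma grad_eqI: "GDERIV f z :> g \<Longrightarrow> grad f z = g"
  unfolding grad_def
proof (rule the_equality)
  fix g' assume "GDERIV f z :> g" "GDERIV f z :> g'"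
  then have "(\<lambda>u. u \<bullet> g) = (\<lambda>u. u \<bullet> g')"
    unfolding gderiv_def by (rule has_derivative_unique)
  then show "g' = g" by (metis vector_eq_ldot)
qed

lemma grad_least_squares:
  fixes A :: "real^'n^'m"
  shows "grad (\<lambda>z. (1/2) * (norm (A *v z - b))\<^sup>2) z = transpose A *v (A *v z - b)"
proof (rule grad_eqI)
  have "((\<lambda>z. A *v z - b) has_derivative (\<lambda>u. A *v u)) (at z)"
    using has_derivative_diff[OF bounded_linear_imp_has_derivative[OF matrix_vector_mul_bounded_linear]
        has_derivative_const] by simp
  from has_derivative_inner[OF this this]
  have "((\<lambda>z. (1/2) * ((A *v z - b) \<bullet> (A *v z - b))) has_derivative
      (\<lambda>u. (1/2) * ((A *v z - b) \<bullet> (A *v u) + (A *v u) \<bullet> (A *v z - b)))) (at z)"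
    by (rule has_derivative_mult_right)
  moreover have "(1/2) * ((A *v z - b) \<bullet> (A *v u) + (A *v u) \<bullet> (A *v z - b))
      = u \<bullet> (transpose A *v (A *v z - b))" for u
    unfolding inner_commute[of u] inner_transpose_mult by (simp add: inner_commute)
  ultimately show "GDERIV (\<lambda>z. (1/2) * (norm (A *v z - b))\<^sup>2) z :> transpose A *v (A *v z - b)"
    unfolding gderiv_def power2_norm_eq_inner by simp
qed

lemma orth_proj_eqI:
  assumes S: "subspace S" and p: "p \<in> S" "\<And>s. s \<in> S \<Longrightarrow> orthogonal (v - p) s"
  shows "orth_proj S v = p"
  unfolding orth_proj_def
proof (rule the_equality)
  fix q assume q: "q \<in> S \<and> (\<forall>s\<in>S. orthogonal (v - q) s)"
  then have "p - q \<in> S" using subspace_diff[OF S p(1)] by blast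
  then have "(v - q) \<bullet> (p - q) = 0" "(v - p) \<bullet> (p - q) = 0"
    using p(2) q unfolding orthogonal_def by blast+
  then have "(p - q) \<bullet> (p - q) = 0" by (simp add: inner_diff_left)
  then show "q = p" by simp
qed (use p in blast)

text \<open>The componentwise product turns the abstract Jacobian into multiplication by \<open>2 x\<close>,
  which is what decouples the iteration.\<close>

lemma jacobian_square_mult:
  fixes x u :: "real^'n"
  shows "jacobian (\<lambda>u. u * u) (at x) *v u = 2 *\<^sub>R (x * u)"
proof -
  have "((\<lambda>u. u * u) has_derivative (\<lambda>u. 2 *\<^sub>R (x * u))) (at x)"
  proof (subst has_derivative_componentwise_within, intro ballI)
    fix i :: "real^'n" assume "i \<in> Basis"
    then obtain k where i: "i = axis k 1" by (auto simp: Basis_vec_def)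
    have "((\<lambda>u. u $ k) has_derivative (\<lambda>u. u $ k)) (at x)"
      by (rule bounded_linear_imp_has_derivative[OF bounded_linear_vec_nth])
    from has_derivative_mult[OF this this]
    show "((\<lambda>u. (u * u) \<bullet> i) has_derivative (\<lambda>u. (2 *\<^sub>R (x * u)) \<bullet> i)) (at x)"
      unfolding i inner_axis by (simp add: mult.commute flip: mult_2)
  qed
  then have "frechet_derivative (\<lambda>u. u * u) (at x) = (\<lambda>u. 2 *\<^sub>R (x * u))"
    by (rule frechet_derivative_at[symmetric])
  moreover have "linear (\<lambda>u. 2 *\<^sub>R (x * u))"
    by (rule linearI) (simp_all add: vec_eq_iff algebra_simps)
  ultimately show ?thesis by (simp add: jacobian_def matrix_works)
qed

lemma transpose_jacobian_square_mult:
  fixes x u :: "real^'n"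
  shows "transpose (jacobian (\<lambda>u. u * u) (at x)) *v u = 2 *\<^sub>R (x * u)"
proof -
  have "(transpose (jacobian (\<lambda>u. u * u) (at x)) *v u) \<bullet> w = (2 *\<^sub>R (x * u)) \<bullet> w" for w
    unfolding inner_transpose_mult jacobian_square_mult
    by (simp add: inner_vec_def sum_distrib_left algebra_simps)
  then show ?thesis using vector_eq_rdot by blast
qed

text \<open>The range of \<open>2 diag x\<close> consists of the vectors that vanish where \<open>x\<close> does.\<close>

lemma orth_proj_range_jacobian_square:
  fixes x v :: "real^'n"
  shows "orth_proj (range (\<lambda>u. jacobian (\<lambda>u. u * u) (at x) *v u)) v = (\<chi> i. if x $ i = 0 then 0 else v $ i)"
    (is "orth_proj ?R v = ?p")
proof (rule orth_proj_eqI)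
  show "subspace ?R" by (intro linear_subspace_image subspace_UNIV matrix_vector_mul_linear)
  show "?p \<in> ?R"
    by (rule image_eqI[where x = "\<chi> i. v $ i / (2 * x $ i)"]) (auto simp: jacobian_square_mult vec_eq_iff)
  show "orthogonal (v - ?p) s" if "s \<in> ?R" for s
    using that by (auto simp: orthogonal_def jacobian_square_mult inner_vec_def intro!: sum.neutral)
qed

lemma matrix_inv_mult_eqI:
  fixes B :: "real^'n^'n"
  assumes inj: "\<And>u. B *v u = 0 \<Longrightarrow> u = 0" and "B *v u = w"
  shows "matrix_inv B *v w = u"
proof -
  have "invertible B"
    using inj by (auto simp: invertible_left_inverse matrix_left_invertible_ker)
  then have "matrix_inv B ** B = mat 1"
    unfolding invertible_def matrix_inv_def by (rule someI2_ex) simp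
  then show ?thesis unfolding assms(2)[symmetric] by (simp add: matrix_vector_mul_assoc)
qed

text \<open>The matrix to be inverted is diagonal with entries \<open>4 x\<^sub>i\<^sup>2 + l\<close>.\<close>

lemma damped_step_square:
  fixes x v :: "real^'n"
  assumes "0 < l"
  defines "J \<equiv> jacobian (\<lambda>u. u * u) (at x)"
  shows "matrix_inv (transpose J ** J + l *\<^sub>R mat 1) *v (transpose J *v v)
    = (\<chi> i. 2 * x $ i * v $ i / (4 * (x $ i)\<^sup>2 + l))"
proof (rule matrix_inv_mult_eqI)
  have pos: "0 < 4 * (x $ i)\<^sup>2 + l" for i
    using \<open>0 < l\<close> by (simp add: add_nonneg_pos)
  have B: "((transpose J ** J + l *\<^sub>R mat 1) *v u) $ i = (4 * (x $ i)\<^sup>2 + l) * u $ i" for u i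
    unfolding J_def
    by (simp add: matrix_vector_mult_add_rdistrib scaleR_matrix_vector_assoc[symmetric]
        jacobian_square_mult transpose_jacobian_square_mult power2_eq_square algebra_simps
        flip: matrix_vector_mul_assoc)
  show "u = 0" if "(transpose J ** J + l *\<^sub>R mat 1) *v u = 0" for u
    using that B[of u] pos by (metis mult_eq_0_iff order_less_irrefl vec_eq_iff zero_index)
  show "(transpose J ** J + l *\<^sub>R mat 1) *v (\<chi> i. 2 * x $ i * v $ i / (4 * (x $ i)\<^sup>2 + l)) = transpose J *v v"
    unfolding vec_eq_iff B using pos
    by (simp add: J_def transpose_jacobian_square_mult less_imp_neq[symmetric])
qed

section \<open>Decrease of the distance in one step\<close>

text \<open>For \<open>e = z - zs\<close>, the left-hand side dominates what the damping takes away from \<open>e \<bullet> v\<close>.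
  Off the support of \<open>zs\<close>, \<open>e\<^sub>i = z\<^sub>i\<close> cancels the denominator, at the cost of an \<open>\<ell>\<^sub>1\<close> norm and thus of the
  square root of the number of such coordinates; on the support \<open>z\<^sub>i \<ge> d\<close> keeps the denominator
  large.  Each of the two parts contributes half of the bound, the second through the \<open>1\<close> in the maximum.\<close>

lemma damping_loss_bound:
  fixes z zs v :: "real^'n"
  defines "d \<equiv> norm (z - zs)"
  assumes z: "\<And>i. 0 \<le> z $ i" and zs: "\<And>i. zs $ i \<noteq> 0 \<Longrightarrow> 2 * d \<le> zs $ i"
    and d: "0 < d" and l: "0 < l" "l \<le> C * d"
  shows "(\<Sum>i\<in>UNIV. l / (4 * z $ i + l) * \<bar>(z - zs) $ i * v $ i\<bar>)
    \<le> C / 2 * max (sqrt (real (card {i. zs $ i = 0}))) 1 * d * norm v"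
proof -
  let ?S = "{i. zs $ i = 0}" and ?s = "max (sqrt (real (card {i. zs $ i = 0}))) 1"
  have "0 < C * d" using l by simp
  then have C: "0 < C" using d by (simp add: zero_less_mult_iff)
  have norm_L2: "norm u = L2_set (\<lambda>i. u $ i) UNIV" for u :: "real^'n"
    by (simp add: norm_vec_def L2_set_def)
  have "l / (4 * z $ i + l) * \<bar>(z - zs) $ i * v $ i\<bar>
      \<le> (if i \<in> ?S then l / 4 * \<bar>v $ i\<bar> else 0) + C / 4 * (\<bar>(z - zs) $ i\<bar> * \<bar>v $ i\<bar>)" for i
  proof (cases "zs $ i = 0")
    case True
    have "l / (4 * z $ i + l) * z $ i \<le> l / 4"
      using z[of i] l by (simp add: field_simps)
    then have "l / (4 * z $ i + l) * z $ i * \<bar>v $ i\<bar> \<le> l / 4 * \<bar>v $ i\<bar>"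
      by (intro mult_right_mono) auto
    moreover have "0 \<le> C / 4 * (\<bar>(z - zs) $ i\<bar> * \<bar>v $ i\<bar>)"
      using C by simp
    moreover have "l / (4 * z $ i + l) * \<bar>(z - zs) $ i * v $ i\<bar> = l / (4 * z $ i + l) * z $ i * \<bar>v $ i\<bar>"
      using True z[of i] by (simp add: abs_mult)
    ultimately have "l / (4 * z $ i + l) * \<bar>(z - zs) $ i * v $ i\<bar>
        \<le> l / 4 * \<bar>v $ i\<bar> + C / 4 * (\<bar>(z - zs) $ i\<bar> * \<bar>v $ i\<bar>)"
      by linarith
    then show ?thesis
      using True by (simp only: mem_Collect_eq simp_thms if_True)
  next
    case False
    have "\<bar>(z - zs) $ i\<bar> \<le> d" unfolding d_def by (rule component_le_norm_cart)
    then have "d \<le> z $ i" using zs[OF False] by simp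
    have "l / (4 * z $ i + l) \<le> C * d / (4 * d)"
      using l \<open>d \<le> z $ i\<close> d by (intro frac_le) auto
    then have "l / (4 * z $ i + l) \<le> C / 4" using d by simp
    then have "l / (4 * z $ i + l) * \<bar>(z - zs) $ i * v $ i\<bar> \<le> C / 4 * \<bar>(z - zs) $ i * v $ i\<bar>"
      by (intro mult_right_mono) auto
    then show ?thesis using False by (simp add: abs_mult)
  qed
  then have "(\<Sum>i\<in>UNIV. l / (4 * z $ i + l) * \<bar>(z - zs) $ i * v $ i\<bar>)
      \<le> (\<Sum>i\<in>UNIV. (if i \<in> ?S then l / 4 * \<bar>v $ i\<bar> else 0) + C / 4 * (\<bar>(z - zs) $ i\<bar> * \<bar>v $ i\<bar>))"
    by (intro sum_mono)
  also have "\<dots> = l / 4 * (\<Sum>i\<in>?S. \<bar>1\<bar> * \<bar>v $ i\<bar>) + C / 4 * (\<Sum>i\<in>UNIV. \<bar>(z - zs) $ i\<bar> * \<bar>v $ i\<bar>)"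
    by (simp add: sum.distrib sum_distrib_left sum.If_cases)
  also have "(\<Sum>i\<in>?S. \<bar>1\<bar> * \<bar>v $ i\<bar>) \<le> L2_set (\<lambda>_. 1) ?S * L2_set (\<lambda>i. v $ i) ?S"
    by (rule L2_set_mult_ineq)
  also have "L2_set (\<lambda>_. 1) ?S = sqrt (real (card ?S))"
    by (simp add: L2_set_def)
  also have "L2_set (\<lambda>i. v $ i) ?S \<le> norm v"
    unfolding norm_L2 L2_set_def by (intro real_sqrt_le_mono sum_mono2) auto
  also have "(\<Sum>i\<in>UNIV. \<bar>(z - zs) $ i\<bar> * \<bar>v $ i\<bar>) \<le> d * norm v"
    unfolding d_def norm_L2 by (rule L2_set_mult_ineq)
  finally have "(\<Sum>i\<in>UNIV. l / (4 * z $ i + l) * \<bar>(z - zs) $ i * v $ i\<bar>)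
      \<le> l / 4 * (sqrt (real (card ?S)) * norm v) + C / 4 * (d * norm v)"
    using l C by (simp add: mult_left_mono)
  also have "l / 4 * (sqrt (real (card ?S)) * norm v) \<le> C * d / 4 * (?s * norm v)"
    using l by (intro mult_mono divide_right_mono mult_right_mono) auto
  also have "C / 4 * (d * norm v) \<le> C / 4 * (?s * (d * norm v))"
    using C d mult_right_mono[of 1 ?s "d * norm v"] by (intro mult_left_mono) auto
  finally show ?thesis by (simp add: algebra_simps)
qed

text \<open>The step works because \<open>e \<bullet> v = 2 \<phi>\<close> (Euler's identity for a homogeneous quadratic form of value \<open>\<phi>\<close> and gradient
  \<open>v\<close> at \<open>e\<close>) and because the damping loses little of this inner product.  The same inner product bounds
  \<open>\<parallel>w\<parallel>\<close> from below, so that the Polyak stepsize is not too long.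
  The vector \<open>w\<close> is the part of \<open>v\<close> on the coordinates that the step can change.\<close>

lemma damped_polyak_step_decrease:
  fixes z zs v :: "real^'n" and \<gamma> \<phi> c l :: real
  defines "e \<equiv> z - zs" and "d \<equiv> norm (z - zs)" and "w \<equiv> \<chi> i. if z $ i = 0 then 0 else v $ i"
  defines "g \<equiv> \<gamma> * (\<phi> / (norm w)\<^sup>2)"
  assumes z: "\<And>i. 0 \<le> z $ i" and c: "0 < c" and l: "0 < l" "c * d \<le> l"
    and \<gamma>: "0 < \<gamma>" "\<gamma> \<le> 1" "\<gamma> \<le> c / 2"
    and \<phi>: "0 < \<phi>" "e \<bullet> v = 2 * \<phi>"
    and loss: "(\<Sum>i\<in>UNIV. l / (4 * z $ i + l) * \<bar>e $ i * v $ i\<bar>) \<le> \<phi> / 256"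
  shows "(norm ((\<chi> i. z $ i * (1 - 2 * g * v $ i / (4 * z $ i + l))\<^sup>2) - zs))\<^sup>2
    \<le> d\<^sup>2 - \<gamma> * (\<phi>\<^sup>2 / (norm v)\<^sup>2)"
proof -
  define a :: "real^'n" where "a = (\<chi> i. 4 * z $ i / (4 * z $ i + l) * v $ i)"
  define t :: "real^'n" where "t = (\<chi> i. g * v $ i / (4 * z $ i + l))"
  have den: "0 < 4 * z $ i + l" for i using z[of i] l by simp
  have a_le_w: "\<bar>a $ i\<bar> \<le> \<bar>w $ i\<bar>" for i
  proof (cases "z $ i = 0")
    case False
    have "\<bar>4 * z $ i / (4 * z $ i + l)\<bar> \<le> 1"
      using z[of i] l den[of i] by simp
    then show ?thesis
      using False mult_right_mono[of "\<bar>4 * z $ i / (4 * z $ i + l)\<bar>" 1 "\<bar>v $ i\<bar>"]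
      by (simp only: a_def w_def vec_lambda_beta abs_mult if_False mult_1 abs_ge_zero)
  qed (simp add: a_def)
  have norm_w: "(norm w)\<^sup>2 = (\<Sum>i\<in>UNIV. (w $ i)\<^sup>2)"
    unfolding power2_norm_eq_inner by (simp add: inner_vec_def power2_eq_square)
  have "e $ i * a $ i = e $ i * v $ i - l / (4 * z $ i + l) * (e $ i * v $ i)" for i
    using den[of i] by (simp add: a_def field_simps)
  then have "e \<bullet> a = e \<bullet> v - (\<Sum>i\<in>UNIV. l / (4 * z $ i + l) * (e $ i * v $ i))"
    by (simp add: inner_vec_def sum_subtractf)
  moreover have "(\<Sum>i\<in>UNIV. l / (4 * z $ i + l) * (e $ i * v $ i))
      \<le> (\<Sum>i\<in>UNIV. l / (4 * z $ i + l) * \<bar>e $ i * v $ i\<bar>)"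
    using den l by (intro sum_mono mult_left_mono) (auto simp: less_imp_le)
  ultimately have align: "(511 / 256) * \<phi> \<le> e \<bullet> a"
    using loss \<phi> by simp
  have "e \<bullet> a \<le> norm e * norm a" by (rule norm_cauchy_schwarz)
  also have "\<dots> \<le> d * norm w"
    unfolding d_def e_def using a_le_w by (intro mult_left_mono norm_le_componentwise_cart) auto
  finally have \<phi>_le: "(511 / 256) * \<phi> \<le> d * norm w" using align by simp
  have "0 < d * norm w" using \<phi>_le \<phi>(1) by linarith
  then have d: "0 < d" and w: "0 < norm w"
    unfolding d_def by (metis mult_eq_0_iff norm_ge_zero order_less_le)+
  have g: "0 < g" using \<gamma> \<phi> w by (simp add: g_def)
  have gw: "g * (norm w)\<^sup>2 = \<gamma> * \<phi>" using w by (simp add: g_def)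
  \<comment> \<open>The relative size of the second-order term: \<open>\<gamma> \<phi> / (\<parallel>w\<parallel> c d) \<le> (1/2) (256/511)\<close>, just above \<open>1/4\<close>.\<close>
  have t_le: "\<bar>t $ i\<bar> \<le> 13 / 50" if "w $ i \<noteq> 0" for i
  proof -
    have "\<bar>v $ i\<bar> \<le> norm w" using that component_le_norm_cart[of w i] by (auto simp: w_def split: if_splits)
    then have "g * \<bar>v $ i\<bar> \<le> g * norm w" using g by simp
    moreover have "\<bar>t $ i\<bar> = g * \<bar>v $ i\<bar> / (4 * z $ i + l)"
      using g den[of i] by (simp add: t_def abs_mult)
    moreover have "c * d \<le> 4 * z $ i + l" using l z[of i] by simp
    ultimately have "\<bar>t $ i\<bar> \<le> g * norm w / (c * d)"
      using g c d by (metis frac_le mult_nonneg_nonneg mult_pos_pos norm_ge_zero less_imp_le)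
    also have "g * norm w = \<gamma> * \<phi> / norm w" using w by (simp add: g_def power2_eq_square)
    also have "\<dots> \<le> (c / 2) * (256 / 511 * (d * norm w)) / norm w"
      using \<gamma> \<phi> \<phi>_le c w by (intro divide_right_mono mult_mono) auto
    also have "\<dots> / (c * d) \<le> 13 / 50" using c d w by simp
    finally show ?thesis using c d by (simp add: divide_right_mono)
  qed
  \<comment> \<open>The constant \<open>8/5\<close> bounds \<open>(1 - t\<^sub>i)\<^sup>2 \<le> (63/50)\<^sup>2\<close>, and \<open>2 / c\<close> comes from the cross term
    \<open>2 g e\<^sub>i a\<^sub>i t\<^sub>i\<close>, where \<open>\<bar>e\<^sub>i\<bar> \<le> d\<close> cancels against \<open>l \<ge> c d\<close>.\<close>
  have comp: "(z $ i * (1 - 2 * g * v $ i / (4 * z $ i + l))\<^sup>2 - zs $ i)\<^sup>2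
      \<le> (e $ i)\<^sup>2 - 2 * g * (e $ i * a $ i) + (2 / c + 8 / 5) * g\<^sup>2 * (w $ i)\<^sup>2" for i
  proof (cases "w $ i = 0")
    case True
    then have "a $ i = 0" using a_le_w[of i] by simp
    \<comment> \<open>Such a coordinate is not moved by the step.\<close>
    then have "z $ i = 0 \<or> v $ i = 0" using den[of i] by (auto simp: a_def)
    then show ?thesis using True \<open>a $ i = 0\<close> by (auto simp: e_def)
  next
    case False
    have "z $ i * (1 - 2 * t $ i)\<^sup>2 - zs $ i = e $ i - g * a $ i * (1 - t $ i)"
    proof -
      have "4 * z $ i * t $ i = g * a $ i" by (simp add: t_def a_def)
      then have "g * a $ i * (1 - t $ i) = 4 * z $ i * t $ i * (1 - t $ i)" by simp
      then show ?thesis by (simp add: e_def power2_eq_square algebra_simps)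
    qed
    then have "(z $ i * (1 - 2 * g * v $ i / (4 * z $ i + l))\<^sup>2 - zs $ i)\<^sup>2
        = (e $ i - g * a $ i * (1 - t $ i))\<^sup>2"
      by (simp add: t_def mult.assoc)
    also have "\<dots> = (e $ i)\<^sup>2 - 2 * g * (e $ i * a $ i) + 2 * g * (e $ i * a $ i * t $ i)
        + g\<^sup>2 * ((a $ i)\<^sup>2 * (1 - t $ i)\<^sup>2)"
      by (simp add: power2_eq_square algebra_simps)
    also have "(a $ i)\<^sup>2 * (1 - t $ i)\<^sup>2 \<le> (w $ i)\<^sup>2 * (8 / 5)"
    proof (intro mult_mono)
      show "(a $ i)\<^sup>2 \<le> (w $ i)\<^sup>2" using a_le_w[of i] by (simp add: abs_le_square_iff)
      have "\<bar>1 - t $ i\<bar> \<le> \<bar>63 / 50\<bar>" using t_le[OF False] by linarith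
      then have "(1 - t $ i)\<^sup>2 \<le> (63 / 50)\<^sup>2" by (rule abs_le_square_iff[THEN iffD1])
      then show "(1 - t $ i)\<^sup>2 \<le> 8 / 5" by (simp add: power2_eq_square)
    qed auto
    also have "e $ i * a $ i * t $ i \<le> g * (w $ i)\<^sup>2 / c"
    proof -
      have "\<bar>e $ i\<bar> \<le> d" unfolding d_def e_def by (rule component_le_norm_cart)
      moreover have "\<bar>t $ i\<bar> = g * \<bar>w $ i\<bar> / (4 * z $ i + l)"
        using False g den[of i] by (simp add: t_def w_def abs_mult split: if_splits)
      moreover have "g * \<bar>w $ i\<bar> / (4 * z $ i + l) \<le> g * \<bar>w $ i\<bar> / (c * d)"
        using g c d l z[of i] by (intro divide_left_mono) auto
      ultimately have "\<bar>e $ i\<bar> * \<bar>a $ i\<bar> * \<bar>t $ i\<bar> \<le> d * \<bar>w $ i\<bar> * (g * \<bar>w $ i\<bar> / (c * d))"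
        using a_le_w[of i] d by (intro mult_mono) auto
      also have "\<dots> = g * (w $ i)\<^sup>2 / c"
        using c d by (simp add: power2_eq_square field_simps)
      finally show ?thesis by (metis abs_le_D1 abs_mult)
    qed
    finally show ?thesis using g by (simp add: mult_left_mono algebra_simps power2_eq_square)
  qed
  have "(norm ((\<chi> i. z $ i * (1 - 2 * g * v $ i / (4 * z $ i + l))\<^sup>2) - zs))\<^sup>2
      = (\<Sum>i\<in>UNIV. (z $ i * (1 - 2 * g * v $ i / (4 * z $ i + l))\<^sup>2 - zs $ i)\<^sup>2)"
    unfolding power2_norm_eq_inner by (simp add: inner_vec_def power2_eq_square)
  also have "\<dots> \<le> (\<Sum>i\<in>UNIV. (e $ i)\<^sup>2 - 2 * g * (e $ i * a $ i) + (2 / c + 8 / 5) * g\<^sup>2 * (w $ i)\<^sup>2)"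
    by (intro sum_mono comp)
  also have "\<dots> = e \<bullet> e - 2 * g * (e \<bullet> a) + (2 / c + 8 / 5) * g\<^sup>2 * (norm w)\<^sup>2"
    unfolding norm_w by (simp add: inner_vec_def sum.distrib sum_subtractf sum_distrib_left power2_eq_square)
  also have "\<dots> = d\<^sup>2 - 2 * g * (e \<bullet> a) + (2 * \<gamma> / c + 8 / 5 * \<gamma>) * (g * \<phi>)"
  proof -
    have "g\<^sup>2 * (norm w)\<^sup>2 = g * (\<gamma> * \<phi>)" unfolding gw[symmetric] by (simp add: power2_eq_square)
    then have "(2 / c + 8 / 5) * g\<^sup>2 * (norm w)\<^sup>2 = (2 / c + 8 / 5) * (g * (\<gamma> * \<phi>))"
      by (simp only: mult.assoc)
    also have "\<dots> = (2 * \<gamma> / c + 8 / 5 * \<gamma>) * (g * \<phi>)" by (simp add: algebra_simps)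
    finally show ?thesis unfolding d_def e_def power2_norm_eq_inner by simp
  qed
  also have "\<dots> \<le> d\<^sup>2 - 2 * g * (511 / 256 * \<phi>) + (1 + 8 / 5) * (g * \<phi>)"
  proof -
    have "2 * \<gamma> / c \<le> 1" using \<gamma> c by (simp add: field_simps)
    then show ?thesis
      using align g \<gamma> \<phi> by (intro add_mono diff_mono mult_left_mono mult_right_mono) auto
  qed
  \<comment> \<open>The coefficient of \<open>g \<phi>\<close> is \<open>- 511/128 + 13/5 \<le> - 1\<close>.\<close>
  also have "\<dots> \<le> d\<^sup>2 - g * \<phi>" using mult_pos_pos[OF g \<phi>(1)] by (simp add: mult.commute)
  also have "g * \<phi> = \<gamma> * (\<phi>\<^sup>2 / (norm w)\<^sup>2)" by (simp add: g_def power2_eq_square)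
  also have "d\<^sup>2 - \<gamma> * (\<phi>\<^sup>2 / (norm w)\<^sup>2) \<le> d\<^sup>2 - \<gamma> * (\<phi>\<^sup>2 / (norm v)\<^sup>2)"
  proof -
    have "norm w \<le> norm v" by (rule norm_le_componentwise_cart) (simp add: w_def)
    then show ?thesis using w \<gamma>
      by (intro diff_left_mono mult_left_mono divide_left_mono power_mono mult_pos_pos zero_less_power) auto
  qed
  finally show ?thesis .
qed

text \<open>The conditions on \<open>l\<close> and \<open>C\<close> make the damping loss at most \<open>\<phi> / 256\<close> through
  \<open>\<parallel>v\<parallel> \<le> \<sigma>\<^sub>m\<^sub>a\<^sub>x\<^sup>2 d\<close> and \<open>\<sigma>\<^sub>m\<^sub>i\<^sub>n\<^sup>2 d\<^sup>2 \<le> 2 \<phi>\<close>; the decrease \<open>\<gamma> \<phi>\<^sup>2 / \<parallel>v\<parallel>\<^sup>2\<close> then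
  becomes relative to \<open>d\<^sup>2\<close> by the same singular value bounds.\<close>

lemma least_squares_polyak_step:
  fixes A :: "real^'n^'m" and x zs :: "real^'n" and \<gamma> c C l :: real
  defines "z \<equiv> x * x"
  defines "v \<equiv> transpose A *v (A *v (z - zs))"
    and "\<phi> \<equiv> (1/2) * (norm (A *v (z - zs)))\<^sup>2"
  defines "g \<equiv> \<gamma> * (\<phi> / (norm (\<chi> i. if x $ i = 0 then 0 else v $ i))\<^sup>2)"
  assumes inj: "inj ((*v) A)" and ne: "z \<noteq> zs"
    and near: "\<And>i. zs $ i \<noteq> 0 \<Longrightarrow> 2 * norm (z - zs) \<le> zs $ i"
    and c: "0 < c" and l: "c * norm (z - zs) \<le> l" "l \<le> C * norm (z - zs)"
    and \<gamma>: "0 < \<gamma>" "\<gamma> \<le> 1" "\<gamma> \<le> c / 2"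
    and C: "C * max (sqrt (real (card {i. zs $ i = 0}))) 1 * (sigma_max A)\<^sup>2 \<le> (sigma_min A)\<^sup>2 / 256"
  shows "(norm ((\<chi> i. (x $ i - g * (2 * x $ i * v $ i / (4 * (x $ i)\<^sup>2 + l)))\<^sup>2) - zs))\<^sup>2
    \<le> (1 - \<gamma> / 4 * (sigma_min A / sigma_max A)\<^sup>2) * (norm (z - zs))\<^sup>2"
proof -
  define d s where "d = norm (z - zs)" and "s = max (sqrt (real (card {i. zs $ i = 0}))) 1"
  have d: "0 < d" using ne by (simp add: d_def)
  have smin: "0 < sigma_min A" using inj by (rule sigma_min_pos)
  then have smax: "0 < sigma_max A" using sigma_min_le_sigma_max[OF inj] by simp
  have "0 < c * d" using c d by simp
  then have l0: "0 < l" using l(1) by (simp add: d_def)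
  then have "0 < C * d" using l(2) by (simp add: d_def)
  then have C0: "0 \<le> C" using d by (simp add: zero_less_mult_iff)
  have \<phi>_ge: "(sigma_min A)\<^sup>2 * d\<^sup>2 \<le> 2 * \<phi>"
    using power_mono[OF sigma_min_le_norm_mult[OF inj, of "z - zs"], of 2] smin
    by (simp add: \<phi>_def d_def power_mult_distrib)
  have \<phi>: "0 < \<phi>"
    using \<phi>_ge smin d by (smt (verit) zero_less_power mult_pos_pos)
  have v_le: "norm v \<le> sigma_max A * norm (A *v (z - zs))"
    unfolding v_def by (rule norm_transpose_mult_le_sigma_max)
  also have "\<dots> \<le> sigma_max A * (sigma_max A * d)"
    unfolding d_def using smax by (intro mult_left_mono norm_mult_le_sigma_max) auto
  finally have v_le_d: "norm v \<le> (sigma_max A)\<^sup>2 * d" by (simp add: power2_eq_square)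
  have z: "0 \<le> z $ i" for i by (simp add: z_def)
  have "(\<Sum>i\<in>UNIV. l / (4 * z $ i + l) * \<bar>(z - zs) $ i * v $ i\<bar>) \<le> C / 2 * s * d * norm v"
    unfolding s_def d_def using z near d l0 l by (intro damping_loss_bound) (auto simp: d_def)
  also have "\<dots> \<le> C / 2 * s * d * ((sigma_max A)\<^sup>2 * d)"
    using v_le_d C0 d by (intro mult_left_mono) (auto simp: s_def)
  also have "\<dots> = (C * s * (sigma_max A)\<^sup>2) * (d\<^sup>2 / 2)"
    by (simp add: power2_eq_square)
  also have "\<dots> \<le> ((sigma_min A)\<^sup>2 / 256) * (d\<^sup>2 / 2)"
    using C by (intro mult_right_mono) (auto simp: s_def)
  also have "\<dots> \<le> \<phi> / 256" using \<phi>_ge by linarith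
  finally have loss: "(\<Sum>i\<in>UNIV. l / (4 * z $ i + l) * \<bar>(z - zs) $ i * v $ i\<bar>) \<le> \<phi> / 256" .
  have inner: "(z - zs) \<bullet> v = 2 * \<phi>"
    unfolding v_def inner_commute[of "z - zs"] inner_transpose_mult \<phi>_def power2_norm_eq_inner by simp
  have g: "g = \<gamma> * (\<phi> / (norm (\<chi> i. if z $ i = 0 then 0 else v $ i))\<^sup>2)"
    by (simp add: g_def z_def)
  have factor: "(x $ i - g * (2 * x $ i * v $ i / (4 * (x $ i)\<^sup>2 + l)))\<^sup>2
      = z $ i * (1 - 2 * g * v $ i / (4 * z $ i + l))\<^sup>2" for i
  proof -
    have "x $ i - g * (2 * x $ i * v $ i / (4 * (x $ i)\<^sup>2 + l))
        = x $ i * (1 - 2 * g * v $ i / (4 * z $ i + l))"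
      by (simp add: z_def power2_eq_square algebra_simps)
    then show ?thesis by (simp add: power_mult_distrib z_def power2_eq_square)
  qed
  have "(norm ((\<chi> i. (x $ i - g * (2 * x $ i * v $ i / (4 * (x $ i)\<^sup>2 + l)))\<^sup>2) - zs))\<^sup>2
      \<le> d\<^sup>2 - \<gamma> * (\<phi>\<^sup>2 / (norm v)\<^sup>2)"
    unfolding factor unfolding g d_def
    by (rule damped_polyak_step_decrease[OF z c l0 l(1) \<gamma> \<phi> inner loss])
  moreover have "\<gamma> / 4 * (sigma_min A / sigma_max A)\<^sup>2 * d\<^sup>2 \<le> \<gamma> * (\<phi>\<^sup>2 / (norm v)\<^sup>2)"
  proof -
    have "(norm v)\<^sup>2 \<le> (sigma_max A)\<^sup>2 * (2 * \<phi>)"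
      using power_mono[OF v_le, of 2] by (simp add: power_mult_distrib \<phi>_def)
    moreover have "v \<noteq> 0" using inner \<phi> by auto
    ultimately have "\<phi>\<^sup>2 / ((sigma_max A)\<^sup>2 * (2 * \<phi>)) \<le> \<phi>\<^sup>2 / (norm v)\<^sup>2"
      using \<phi> smax by (intro divide_left_mono) auto
    moreover have "\<phi>\<^sup>2 / ((sigma_max A)\<^sup>2 * (2 * \<phi>)) = \<phi> / (2 * (sigma_max A)\<^sup>2)"
      using \<phi> by (simp add: power2_eq_square)
    moreover have "(sigma_min A)\<^sup>2 * d\<^sup>2 / (4 * (sigma_max A)\<^sup>2) \<le> (2 * \<phi>) / (4 * (sigma_max A)\<^sup>2)"
      using \<phi>_ge by (intro divide_right_mono) auto
    ultimately have "(sigma_min A)\<^sup>2 * d\<^sup>2 / (4 * (sigma_max A)\<^sup>2) \<le> \<phi>\<^sup>2 / (norm v)\<^sup>2" by simp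
    from mult_left_mono[OF this, of \<gamma>] \<gamma> show ?thesis by (simp add: power_divide mult.assoc)
  qed
  ultimately show ?thesis unfolding d_def left_diff_distrib mult_1 by linarith
qed

section \<open>Linear convergence\<close>

theorem corollary5p3:
  fixes A :: "real^'r^'m" and zs :: "real^'r" and b :: "real^'m"
    and F :: "real^'r \<Rightarrow> real^'r" and h :: "real^'r \<Rightarrow> real"
    and x :: "nat \<Rightarrow> real^'r" and gam lam :: "nat \<Rightarrow> real"
    and \<gamma> Clb Cub :: real and rs :: nat
  assumes dims: "CARD('r) \<le> CARD('m)"
    and full_rank: "rank A = CARD('r)"
    and zs_nonneg: "\<And>i. 0 \<le> zs $ i"
    and rs: "rs = card (supp zs)"
    and b: "b = A *v zs"
    and F: "F = (\<lambda>u. u * u)"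
    and h: "h = (\<lambda>z. (1/2) * (norm (A *v z - b))\<^sup>2)"
    and lmm: "lmm_iterates h F gam lam x"
    and polyak: "polyak_config h F \<gamma> Clb Cub gam lam x"
    and gamma_le: "\<gamma> \<le> min 1 (Clb / 2)"
    and Cub_le: "Cub \<le> inverse (2 ^ 8 * max (sqrt (real CARD('r) - real rs)) 1) * cond_number A powi (-4)"
    and init: "ereal (norm (x 0 * x 0 - zs)) \<le>
      ereal (1/2) *
        min (INF (i, j)\<in>{(i, j). zs $ i \<noteq> zs $ j}. ereal \<bar>zs $ i - zs $ j\<bar>)
            (INF i\<in>{i. zs $ i \<noteq> 0}. ereal (zs $ i))"
  shows "\<forall>k. (norm (x k * x k - zs))\<^sup>2 \<le>
           (1 - \<gamma> / 32 * cond_number A powi (-2)) ^ k * (norm (x 0 * x 0 - zs))\<^sup>2"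
proof -
  let ?d = "\<lambda>k. norm (x k * x k - zs)"
  \<comment> \<open>The contraction factor that the one-step estimate yields; it is at most the claimed one.\<close>
  define q where "q = 1 - \<gamma> / 4 * (sigma_min A / sigma_max A)\<^sup>2"
  have inj: "inj ((*v) A)" using full_rank by (simp add: full_rank_injective)
  have smin: "0 < sigma_min A" using inj by (rule sigma_min_pos)
  have smin_le: "sigma_min A \<le> sigma_max A" using inj by (rule sigma_min_le_sigma_max)
  then have smax: "0 < sigma_max A" using smin by simp
  have ratio: "sigma_min A / sigma_max A \<le> 1" using smin_le smax by simp

  have h': "h = (\<lambda>z. (1/2) * (norm (A *v (z - zs)))\<^sup>2)"
    unfolding h b by (simp add: matrix_vector_mult_diff_distrib)
  have h_pos: "0 < h z" if "z \<noteq> zs" for z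
  proof -
    have "0 < sigma_min A * norm (z - zs)" using smin that by simp
    then have "0 < norm (A *v (z - zs))"
      using sigma_min_le_norm_mult[OF inj, of "z - zs"] by linarith
    then show ?thesis unfolding h' by (intro mult_pos_pos zero_less_power) auto
  qed
  have h_zs: "h zs = 0" by (simp add: h')
  have zs_range: "zs \<in> range F"
    unfolding F using zs_nonneg by (intro image_eqI[of _ _ "\<chi> i. sqrt (zs $ i)"]) (auto simp: vec_eq_iff)
  have min_val: "min_val h F = 0"
    unfolding min_val_def
  proof (rule cInf_eq_minimum)
    show "0 \<in> h ` range F" using zs_range h_zs by force
  qed (auto simp: h')
  have minimizers: "minimizers h F = {zs}"
  proof (intro equalityI subsetI)
    fix z assume "z \<in> minimizers h F"
    then have "\<not> h zs < h z" using zs_range by (auto simp: minimizers_def is_arg_min_def)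
    then show "z \<in> {zs}" using h_pos h_zs by auto
  next
    fix z assume "z \<in> {zs}"
    then show "z \<in> minimizers h F"
      using zs_range h_zs by (auto simp: minimizers_def is_arg_min_def h' not_less)
  qed
  have grad: "grad h z = transpose A *v (A *v (z - zs))" for z
    unfolding h b grad_least_squares by (simp add: matrix_vector_mult_diff_distrib)

  have par: "0 < \<gamma>" "0 < Clb" "\<gamma> \<le> 1" "\<gamma> \<le> Clb / 2"
    using polyak gamma_le by (auto simp: polyak_config_def)
  have gam: "gam k = \<gamma> * (h (x k * x k) / (norm (\<chi> i. if x k $ i = 0 then 0 else grad h (x k * x k) $ i))\<^sup>2)"
    and lam: "Clb * ?d k \<le> lam k" "lam k \<le> Cub * ?d k" for k
    using polyak unfolding polyak_config_def F min_val[unfolded F] minimizers[unfolded F] Let_def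
      orth_proj_range_jacobian_square by (auto simp: dist_norm)
  have upd: "x (Suc k) = x k - gam k *\<^sub>R
      (let J = jacobian (\<lambda>u. u * u) (at (x k)) in
       matrix_inv (transpose J ** J + lam k *\<^sub>R mat 1) *v (transpose J *v grad h (x k * x k)))" for k
    using lmm unfolding lmm_iterates_def F Let_def by blast

  have near: "2 * ?d 0 \<le> zs $ i" if "zs $ i \<noteq> 0" for i
  proof -
    have "min (INF (i, j)\<in>{(i, j). zs $ i \<noteq> zs $ j}. ereal \<bar>zs $ i - zs $ j\<bar>)
        (INF i\<in>{i. zs $ i \<noteq> 0}. ereal (zs $ i)) \<le> ereal (zs $ i)"
      using that by (intro min.coboundedI2 INF_lower) auto
    then have "ereal (?d 0) \<le> ereal (1/2) * ereal (zs $ i)"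
      by (intro order_trans[OF init] ereal_mult_left_mono) auto
    then show ?thesis by simp
  qed

  have "card {i. zs $ i = 0} + rs = CARD('r)"
  proof -
    have "{i. zs $ i = 0} = - supp zs" by (auto simp: supp_def)
    then show ?thesis by (simp add: rs Compl_eq_Diff_UNIV card_Diff_subset card_mono)
  qed
  then have zeros: "real (card {i. zs $ i = 0}) = real CARD('r) - real rs" by linarith
  \<comment> \<open>Of the factor \<open>\<kappa>\<^sup>-\<^sup>4\<close> in the bound on \<open>Cub\<close>, two powers turn \<open>\<sigma>\<^sub>m\<^sub>a\<^sub>x\<^sup>2\<close> into
    \<open>\<sigma>\<^sub>m\<^sub>i\<^sub>n\<^sup>2\<close>, and the other two are at most \<open>1\<close>.\<close>
  have C: "Cub * max (sqrt (real (card {i. zs $ i = 0}))) 1 * (sigma_max A)\<^sup>2 \<le> (sigma_min A)\<^sup>2 / 256"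
  proof -
    let ?s = "max (sqrt (real (card {i. zs $ i = 0}))) 1"
    have "Cub * ?s \<le> inverse (2 ^ 8 * ?s) * (sigma_min A / sigma_max A) ^ 4 * ?s"
      using Cub_le unfolding zeros cond_number_def
      by (intro mult_right_mono) (auto simp: power_int_minus power_divide)
    also have "\<dots> = (sigma_min A / sigma_max A) ^ 4 / 256"
      by (simp add: field_simps)
    finally have "Cub * ?s * (sigma_max A)\<^sup>2 \<le> (sigma_min A / sigma_max A) ^ 4 / 256 * (sigma_max A)\<^sup>2"
      by (intro mult_right_mono) auto
    also have "\<dots> = (sigma_min A / sigma_max A)\<^sup>2 * ((sigma_min A)\<^sup>2 / 256)"
      using smax by (simp add: field_simps power2_eq_square power4_eq_xxxx)
    also have "\<dots> \<le> 1 * ((sigma_min A)\<^sup>2 / 256)"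
      using ratio smin smax by (intro mult_right_mono power_le_one) auto
    finally show ?thesis by simp
  qed

  have step: "(?d (Suc k))\<^sup>2 \<le> q * (?d k)\<^sup>2" if "?d k \<le> ?d 0" for k
  proof (cases "x k * x k = zs")
    case True
    \<comment> \<open>At the minimizer the gradient vanishes, so the iterate stays, whatever the inverse of the possibly
      singular matrix is.\<close>
    then have "x (Suc k) = x k" unfolding upd grad by (simp add: Let_def)
    then show ?thesis using True by simp
  next
    case False
    then have "0 < Clb * ?d k" using par by simp
    then have "0 < lam k" using lam(1)[of k] by linarith
    then have "x (Suc k) * x (Suc k)
        = (\<chi> i. (x k $ i - gam k * (2 * x k $ i * grad h (x k * x k) $ i / (4 * (x k $ i)\<^sup>2 + lam k)))\<^sup>2)"
      unfolding upd Let_def by (simp add: damped_step_square vec_eq_iff power2_eq_square)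
    moreover have "2 * ?d k \<le> zs $ i" if "zs $ i \<noteq> 0" for i
      using near[OF that] \<open>?d k \<le> ?d 0\<close> by linarith
    ultimately show ?thesis
      using least_squares_polyak_step[OF inj False _ par(2) lam par(1,3,4) C]
      unfolding gam grad q_def unfolding h' by simp
  qed
  have q: "0 \<le> q" "q \<le> 1"
  proof -
    have "(sigma_min A / sigma_max A)\<^sup>2 \<le> 1"
      using ratio smin smax by (intro power_le_one) auto
    then have "\<gamma> / 4 * (sigma_min A / sigma_max A)\<^sup>2 \<le> 1 * 1"
      using par by (intro mult_mono) auto
    then show "0 \<le> q" "q \<le> 1" using par by (auto simp: q_def)
  qed
  have rate: "(?d k)\<^sup>2 \<le> q ^ k * (?d 0)\<^sup>2" for k
  proof (induction k)
    case (Suc k)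
    have "q ^ k * (?d 0)\<^sup>2 \<le> 1 * (?d 0)\<^sup>2"
      using q by (intro mult_right_mono power_le_one) auto
    with Suc.IH have "(?d k)\<^sup>2 \<le> (?d 0)\<^sup>2" by linarith
    then have "?d k \<le> ?d 0" by (rule power2_le_imp_le) simp
    then have "(?d (Suc k))\<^sup>2 \<le> q * (?d k)\<^sup>2" by (rule step)
    also have "\<dots> \<le> q * (q ^ k * (?d 0)\<^sup>2)" using Suc.IH q(1) by (rule mult_left_mono)
    finally show ?case by simp
  qed simp
  have q_le: "q \<le> 1 - \<gamma> / 32 * cond_number A powi (-2)"
  proof -
    have "cond_number A powi (-2) = (sigma_min A / sigma_max A)\<^sup>2"
      by (simp add: cond_number_def power_int_minus power_divide)
    moreover have "\<gamma> / 32 * (sigma_min A / sigma_max A)\<^sup>2 \<le> \<gamma> / 4 * (sigma_min A / sigma_max A)\<^sup>2"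
      using par by (intro mult_right_mono) auto
    ultimately show ?thesis by (simp add: q_def)
  qed
  show ?thesis
  proof
    fix k
    have "q ^ k * (?d 0)\<^sup>2 \<le> (1 - \<gamma> / 32 * cond_number A powi (-2)) ^ k * (?d 0)\<^sup>2"
      using q_le q(1) by (intro mult_right_mono power_mono) auto
    with rate[of k] show "(?d k)\<^sup>2 \<le> (1 - \<gamma> / 32 * cond_number A powi (-2)) ^ k * (?d 0)\<^sup>2"
      by linarith
  qed
qed

end
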